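(* Suppose that $\lim_{x\to\infty}\big(\mathrm{pen}_D(x)-\log x\big)=\infty$. Then for every $p\times p$ positive semidefinite matrix $S$ the penalised likelihood estimate $\hat\Theta_{\mathrm{Pen}}$ exists.
   Context: Fix an integer $p\ge 1$. All matrices are real symmetric $p\times p$; $\Theta=(\theta_{ij})\succ 0$ means $\Theta$ is positive definite. The diagonal penalty $\mathrm{pen}_D:(0,\infty)\to\mathbb{R}$ is non-negative, non-decreasing and continuous. The off-diagonal penalty $\mathrm{pen}:\mathbb{R}\to\mathbb{R}$ is an arbitrary function that is non-negative, symmetric around $0$, non-decreasing in $|x|$ and continuous (in particular $\mathrm{pen}=0$ is allowed). Define $$\mathrm{Pen}(\Theta)=\sum_{i=1}^p \mathrm{pen}_D(\theta_{ii})+\sum_{i<j}\mathrm{pen}(\theta_{ij}),\qquad l_{\mathrm{Pen}}(\Theta\mid S)=\log\det\Theta-\mathrm{tr}(S\Theta)-\mathrm{Pen}(\Theta),\quad \Theta\succ 0.$$ The penalised likelihood estimate is $\hat\Theta_{\mathrm{Pen}}=\mathrm{argmax}_{\Theta\succ 0}\, l_{\mathrm{Pen}}(\Theta\mid S)$; it is said to exist if the supremum of $l_{\mathrm{Pen}}(\cdot\mid S)$ over positive definite $\Theta$ is finite and attained. *)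

theory Defs
  imports "HOL-Analysis.Analysis"
begin

definition pos_def_matrix :: "real^'p^'p \<Rightarrow> bool" where
  "pos_def_matrix A \<longleftrightarrow> transpose A = A \<and> (\<forall>x. x \<noteq> 0 \<longrightarrow> 0 < x \<bullet> (A *v x))"

definition pos_semidef_matrix :: "real^'p^'p \<Rightarrow> bool" where
  "pos_semidef_matrix A \<longleftrightarrow> transpose A = A \<and> (\<forall>x. 0 \<le> x \<bullet> (A *v x))"

(* The mathematical domain of a diagonal penalty is the open half-line; its values at
   nonpositive arguments are irrelevant and left unconstrained. *)
definition diag_penalty :: "(real \<Rightarrow> real) \<Rightarrow> bool" where
  "diag_penalty penD \<longleftrightarrow>
     (\<forall>x>0. 0 \<le> penD x) \<and> mono_on {0<..} penD \<and> continuous_on {0<..} penD"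

definition offdiag_penalty :: "(real \<Rightarrow> real) \<Rightarrow> bool" where
  "offdiag_penalty pen \<longleftrightarrow>
     (\<forall>x. 0 \<le> pen x) \<and> (\<forall>x. pen (- x) = pen x) \<and>
     (\<forall>x y. \<bar>x\<bar> \<le> \<bar>y\<bar> \<longrightarrow> pen x \<le> pen y) \<and> continuous_on UNIV pen"

(* The order on the index type serves only to enumerate each unordered pair of distinct
   indices once; every p >= 1 is the cardinality of a finite linearly ordered type. *)
definition Pen ::
  "(real \<Rightarrow> real) \<Rightarrow> (real \<Rightarrow> real) \<Rightarrow> real^('p::{finite,linorder})^('p::{finite,linorder}) \<Rightarrow> real" where
  "Pen penD pen \<Theta> =
     (\<Sum>i\<in>UNIV. penD (\<Theta> $ i $ i)) + (\<Sum>(i, j)\<in>{(i, j). i < j}. pen (\<Theta> $ i $ j))"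

definition l_Pen ::
  "(real \<Rightarrow> real) \<Rightarrow> (real \<Rightarrow> real) \<Rightarrow> real^('p::{finite,linorder})^('p::{finite,linorder}) \<Rightarrow>
     real^('p::{finite,linorder})^('p::{finite,linorder}) \<Rightarrow> real" where
  "l_Pen penD pen S \<Theta> = ln (det \<Theta>) - trace (S ** \<Theta>) - Pen penD pen \<Theta>"

(* Sup on the reals is meaningful only together with the boundedness conjunct, which says
   that the supremum is finite. *)
definition penalised_estimate_exists ::
  "(real \<Rightarrow> real) \<Rightarrow> (real \<Rightarrow> real) \<Rightarrow> real^('p::{finite,linorder})^('p::{finite,linorder}) \<Rightarrow> bool" where
  "penalised_estimate_exists penD pen S \<longleftrightarrow>
     bdd_above (l_Pen penD pen S ` {\<Theta>. pos_def_matrix \<Theta>}) \<and>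
     (\<exists>\<Theta>. pos_def_matrix \<Theta> \<and>
        l_Pen penD pen S \<Theta> = (SUP \<Theta>' \<in> {\<Theta>. pos_def_matrix \<Theta>}. l_Pen penD pen S \<Theta>'))"

end

(* Along positive definite matrices, tr(S Theta) and the off-diagonal penalties are nonnegative and
   Hadamard's inequality bounds log det Theta by the sum of the log theta_ii, so
   l(Theta) <= - sum_i (penD theta_ii - log theta_ii). By coercivity, the superlevel set of l through
   the identity matrix keeps every theta_ii bounded; since penD is nonnegative as well, it also keeps
   det Theta away from 0. Hence it lies in a compact set of positive definite matrices, on which the
   continuous function l attains its maximum. Both Hadamard's inequality and tr(S Theta) >= 0 come
   from V Theta V^T = diag(d) with det V = 1 and 0 < d_i <= theta_ii, obtained by Gram-Schmidt
   orthogonalisation of the standard basis with respect to Theta. *)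
theory Submission
  imports Defs
begin

section \<open>Diagonalisation by congruence, Hadamard's inequality and the trace bound\<close>

lemma symmetric_matrix_inner:
  fixes A :: "real^'n^'n"
  assumes "transpose A = A"
  shows "x \<bullet> (A *v y) = y \<bullet> (A *v x)"
  by (metis assms dot_lmul_matrix inner_commute transpose_matrix_vector)

lemma axis_inner_matrix:
  fixes A :: "real^'n^'n"
  shows "axis i 1 \<bullet> (A *v axis j 1) = A $ i $ j"
  by (simp add: inner_axis' matrix_vector_mul_component inner_axis)

lemma pos_def_matrix_diag_pos:
  assumes "pos_def_matrix A"
  shows "0 < A $ i $ i"
  using assms axis_inner_matrix[of i A i] axis_eq_0_iff[of i "1::real"]
  unfolding pos_def_matrix_def by (metis zero_neq_one)

text \<open>Gram-Schmidt for the form \<open>x \<bullet> (A *v y)\<close>, one index at a time: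
  subtracting a projection can only lower the value of the form, and adding to a row a combination
  of other rows preserves the determinant. Indices outside \<open>F\<close> keep their basis vector,
  so that the determinant is that of a full square matrix at every stage.\<close>

lemma gram_schmidt_pos_def:
  fixes A :: "real^'n^'n"
  assumes A: "pos_def_matrix A" and "finite F"
  shows "\<exists>u :: 'n \<Rightarrow> real^'n.
    (\<forall>i\<in>F. \<forall>j\<in>F. i \<noteq> j \<longrightarrow> u i \<bullet> (A *v u j) = 0) \<and>
    (\<forall>i\<in>F. 0 < u i \<bullet> (A *v u i) \<and> u i \<bullet> (A *v u i) \<le> A $ i $ i) \<and>
    (\<forall>i. i \<notin> F \<longrightarrow> u i = axis i 1) \<and> det (\<chi> i. u i) = 1"
  using \<open>finite F\<close>
proof (induction F)
  case empty
  have "(\<chi> i. axis i (1::real)) = mat 1"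
    by (simp add: vec_eq_iff mat_def axis_def)
  then have "det (\<chi> i. axis i (1::real)) = 1"
    by (metis det_I)
  then show ?case
    by (intro exI[of _ "\<lambda>i. axis i 1"]) simp
next
  case (insert k F)
  then obtain u :: "'n \<Rightarrow> real^'n" where
    orth: "\<And>i j. i \<in> F \<Longrightarrow> j \<in> F \<Longrightarrow> i \<noteq> j \<Longrightarrow> u i \<bullet> (A *v u j) = 0"
    and pos: "\<And>i. i \<in> F \<Longrightarrow> 0 < u i \<bullet> (A *v u i)"
    and le: "\<And>i. i \<in> F \<Longrightarrow> u i \<bullet> (A *v u i) \<le> A $ i $ i"
    and ax: "\<And>i. i \<notin> F \<Longrightarrow> u i = axis i 1"
    and det: "det (\<chi> i. u i) = 1"
    by metis
  have sym: "x \<bullet> (A *v y) = y \<bullet> (A *v x)" for x y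
    using A symmetric_matrix_inner unfolding pos_def_matrix_def by blast
  let ?e = "axis k 1 :: real^'n"
  \<comment> \<open>These are the projection coefficients of \<open>?e\<close> on each
    \<open>u i\<close>; \<open>y\<close> is the projection on the span of the vectors already
    treated and \<open>v\<close> the residual.\<close>
  define c where "c i = (u i \<bullet> (A *v ?e)) / (u i \<bullet> (A *v u i))" for i
  define y where "y = (\<Sum>i\<in>F. c i *s u i)"
  define v where "v = ?e - y"
  define u' where "u' = u(k := v)"
  have yi: "u i \<bullet> (A *v y) = u i \<bullet> (A *v ?e)" if "i \<in> F" for i
  proof -
    have "u i \<bullet> (A *v y) = (\<Sum>j\<in>F. c j * (u i \<bullet> (A *v u j)))"
      unfolding y_def vec.sum vec.scale
      by (simp add: inner_sum_right scalar_mult_eq_scaleR)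
    also have "\<dots> = (\<Sum>j\<in>F. if j = i then c i * (u i \<bullet> (A *v u i)) else 0)"
      using orth that by (intro sum.cong) auto
    also have "\<dots> = u i \<bullet> (A *v ?e)"
      using that pos[OF that] insert.hyps by (simp add: c_def)
    finally show ?thesis .
  qed
  have vi: "u i \<bullet> (A *v v) = 0" if "i \<in> F" for i
    using yi[OF that] by (simp add: v_def vec.diff inner_diff_right)
  \<comment> \<open>Pythagoras: by orthogonality the form at \<open>v\<close> is
    \<open>A $ k $ k\<close> minus \<open>?e \<bullet> (A *v y)\<close>, and the latter is a sum of
    squares over positive numbers.\<close>
  have "y \<bullet> (A *v v) = 0"
    using vi unfolding y_def by (simp add: inner_sum_left scalar_mult_eq_scaleR)
  then have ev: "v \<bullet> (A *v v) = ?e \<bullet> (A *v v)"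
    by (simp add: v_def inner_diff_left)
  have "?e \<bullet> (A *v y) = (\<Sum>i\<in>F. c i * (?e \<bullet> (A *v u i)))"
    unfolding y_def vec.sum vec.scale
    by (simp add: inner_sum_right scalar_mult_eq_scaleR)
  also have "\<dots> = (\<Sum>i\<in>F. (u i \<bullet> (A *v ?e))\<^sup>2 / (u i \<bullet> (A *v u i)))"
    by (intro sum.cong) (auto simp: c_def power2_eq_square sym[of ?e])
  also have "\<dots> \<ge> 0"
    using pos by (intro sum_nonneg) (simp add: less_imp_le)
  finally have vle: "v \<bullet> (A *v v) \<le> A $ k $ k"
    unfolding ev by (simp add: v_def vec.diff inner_diff_right axis_inner_matrix)
  have det': "det (\<chi> i. u' i) = 1"
  proof -
    \<comment> \<open>Since \<open>k\<close> is not in \<open>F\<close>, \<open>y\<close> combines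
      only rows other than row \<open>k\<close>, which itself is still \<open>?e\<close>.\<close>
    have "- y \<in> vec.span {row j (\<chi> i. u i) | j. j \<noteq> k}"
      unfolding y_def using insert.hyps
      by (intro vec.span_neg vec.span_sum vec.span_scale vec.span_base) (auto simp: row_def)
    from det_row_span[OF this] det
    have "det (\<chi> i. if i = k then row k (\<chi> i. u i) + - y else row i (\<chi> i. u i)) = 1"
      by simp
    moreover have "(\<chi> i. if i = k then row k (\<chi> i. u i) + - y else row i (\<chi> i. u i)) = (\<chi> i. u' i)"
      using ax[OF insert.hyps(2)] by (auto simp: vec_eq_iff u'_def v_def row_def)
    ultimately show ?thesis by simp
  qed
  \<comment> \<open>A zero \<open>v\<close> would be a zero row, contradicting determinant 1; no
    separate independence argument is made.\<close>
  have "v \<noteq> 0"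
  proof
    assume "v = 0"
    then have "row k (\<chi> i. u' i) = 0"
      by (simp add: row_def u'_def vec_eq_iff)
    then show False
      using det_zero_row(2) det' by fastforce
  qed
  then have vpos: "0 < v \<bullet> (A *v v)"
    using A unfolding pos_def_matrix_def by blast
  show ?case
  proof (intro exI[of _ u'] conjI ballI allI impI)
    show "u' i \<bullet> (A *v u' j) = 0" if "i \<in> insert k F" "j \<in> insert k F" "i \<noteq> j" for i j
      using that orth[of i j] vi[of i] vi[of j] sym[of v "u j"] by (auto simp: u'_def)
    show "0 < u' i \<bullet> (A *v u' i)" "u' i \<bullet> (A *v u' i) \<le> A $ i $ i" if "i \<in> insert k F" for i
      using that pos[of i] le[of i] vpos vle by (auto simp: u'_def)
    show "u' i = axis i 1" if "i \<notin> insert k F" for i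
      using that ax[of i] by (auto simp: u'_def)
    show "det (\<chi> i. u' i) = 1"
      by (rule det')
  qed
qed

text \<open>With \<open>F = UNIV\<close> and the vectors as rows of \<open>V\<close>, the matrix
  \<open>B\<close> is their Gram matrix for the form given by \<open>A\<close>.\<close>

lemma pos_def_matrix_diagonalise:
  fixes A :: "real^'n^'n"
  assumes "pos_def_matrix A"
  obtains V B :: "real^'n^'n" where
    "det V = 1" "B = V ** A ** transpose V" "\<And>i j. i \<noteq> j \<Longrightarrow> B $ i $ j = 0"
    "\<And>i. 0 < B $ i $ i" "\<And>i. B $ i $ i \<le> A $ i $ i"
proof -
  obtain u :: "'n \<Rightarrow> real^'n" where
    u: "\<And>i j. i \<noteq> j \<Longrightarrow> u i \<bullet> (A *v u j) = 0"
      "\<And>i. 0 < u i \<bullet> (A *v u i)" "\<And>i. u i \<bullet> (A *v u i) \<le> A $ i $ i"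
    and det: "det (\<chi> i. u i) = 1"
    using gram_schmidt_pos_def[OF assms finite_class.finite_UNIV] by (metis UNIV_I)
  let ?V = "\<chi> i. u i"
  have "(?V ** A ** transpose ?V) $ i $ j = u i \<bullet> (A *v u j)" for i j
    unfolding matrix_mul_assoc[symmetric]
    by (simp add: matrix_matrix_mult_def matrix_vector_mult_def inner_vec_def transpose_def)
  then show thesis
    using that[OF det refl] u by simp
qed

lemma det_pos_def_matrix:
  fixes A :: "real^'n^'n"
  assumes "pos_def_matrix A"
  shows "0 < det A" and hadamard_inequality: "det A \<le> (\<Prod>i\<in>UNIV. A $ i $ i)"
proof -
  obtain V B :: "real^'n^'n" where VB:
    "det V = 1" "B = V ** A ** transpose V" "\<And>i j. i \<noteq> j \<Longrightarrow> B $ i $ j = 0"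
    "\<And>i. 0 < B $ i $ i" "\<And>i. B $ i $ i \<le> A $ i $ i"
    using pos_def_matrix_diagonalise[OF assms] by metis
  have "det A = det B"
    using VB(1,2) by (simp add: det_mul)
  also have "\<dots> = (\<Prod>i\<in>UNIV. B $ i $ i)"
    using VB(3) by (rule det_diagonal)
  finally have d: "det A = (\<Prod>i\<in>UNIV. B $ i $ i)" .
  show "0 < det A"
    unfolding d by (intro prod_pos) (simp add: VB(4))
  show "det A \<le> (\<Prod>i\<in>UNIV. A $ i $ i)"
    unfolding d by (intro prod_mono) (auto simp: VB(5) less_imp_le[OF VB(4)])
qed

text \<open>For \<open>W\<close> the inverse of \<open>V\<close>,
  \<open>A = W ** B ** transpose W\<close> with \<open>B\<close> diagonal. Cyclicity of the trace
  then gives a sum of values of the form of \<open>S\<close> at the columns of \<open>W\<close>,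
  weighted by the positive \<open>B $ i $ i\<close>.\<close>

lemma trace_mult_nonneg:
  fixes S A :: "real^'n^'n"
  assumes S: "pos_semidef_matrix S" and A: "pos_def_matrix A"
  shows "0 \<le> trace (S ** A)"
proof -
  obtain V B :: "real^'n^'n" where VB:
    "det V = 1" "B = V ** A ** transpose V" "\<And>i j. i \<noteq> j \<Longrightarrow> B $ i $ j = 0"
    "\<And>i. 0 < B $ i $ i"
    using pos_def_matrix_diagonalise[OF A] by metis
  obtain W where W: "W ** V = mat 1"
    using VB(1) invertible_det_nz[of V] unfolding invertible_def by auto
  then have W': "transpose V ** transpose W = mat 1"
    by (metis matrix_transpose_mul transpose_mat)
  have "W ** B ** transpose W = (W ** V) ** A ** (transpose V ** transpose W)"
    unfolding VB(2) by (simp add: matrix_mul_assoc)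
  then have "A = W ** B ** transpose W"
    by (simp add: W W')
  then have "trace (S ** A) = trace ((S ** W ** B) ** transpose W)"
    by (simp add: matrix_mul_assoc)
  also have "\<dots> = trace ((transpose W ** (S ** W)) ** B)"
    by (subst trace_mul_sym) (simp add: matrix_mul_assoc)
  also have "\<dots> = (\<Sum>i\<in>UNIV. (\<Sum>k\<in>UNIV. (transpose W ** (S ** W)) $ i $ k * B $ k $ i))"
    by (simp add: trace_def matrix_matrix_mult_def)
  also have "\<dots> = (\<Sum>i\<in>UNIV. (\<Sum>k\<in>UNIV. if k = i then (transpose W ** (S ** W)) $ i $ i * B $ i $ i else 0))"
    by (intro sum.cong refl) (auto simp: VB(3))
  also have "\<dots> = (\<Sum>i\<in>UNIV. (column i W \<bullet> (S *v column i W)) * B $ i $ i)"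
    by (simp add: matrix_matrix_mult_def matrix_vector_mult_def inner_vec_def transpose_def column_def)
  also have "\<dots> \<ge> 0"
    using S VB(4) unfolding pos_semidef_matrix_def
    by (intro sum_nonneg mult_nonneg_nonneg) (auto simp: less_imp_le)
  finally show ?thesis .
qed

section \<open>Semidefinite matrices: kernel, entries and compactness\<close>

lemma pos_semidef_matrix_kernel:
  fixes A :: "real^'n^'n"
  assumes A: "pos_semidef_matrix A" and x: "x \<bullet> (A *v x) = 0"
  shows "A *v x = 0"
proof -
  define y where "y = A *v x"
  define q where "q = y \<bullet> (A *v y)"
  have q: "0 \<le> q" using A unfolding pos_semidef_matrix_def q_def by blast
  have xy: "x \<bullet> (A *v y) = y \<bullet> y"
    using symmetric_matrix_inner[of A x y] A unfolding pos_semidef_matrix_def y_def by simp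
  \<comment> \<open>The form at \<open>x - t *s y\<close> is
    \<open>t * (t * q - 2 * (y \<bullet> y))\<close>. This \<open>t\<close> is small enough for
    \<open>t * q \<le> y \<bullet> y\<close>, which makes that value negative unless
    \<open>y = 0\<close>; the summand 1 covers \<open>q = 0\<close>.\<close>
  define t where "t = (y \<bullet> y) / (1 + q)"
  have "0 \<le> (x - t *s y) \<bullet> (A *v (x - t *s y))"
    using A unfolding pos_semidef_matrix_def by blast
  also have "\<dots> = t * (t * q - 2 * (y \<bullet> y))"
    using x xy
    by (simp add: vec.diff vec.scale inner_diff_left inner_diff_right scalar_mult_eq_scaleR
        q_def flip: y_def) (simp add: algebra_simps inner_commute)
  finally have 1: "0 \<le> t * (t * q - 2 * (y \<bullet> y))" .
  have "t * q \<le> y \<bullet> y" "0 \<le> t"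
    using q by (simp_all add: t_def divide_simps algebra_simps)
  then have "t * (t * q - 2 * (y \<bullet> y)) \<le> t * (- (y \<bullet> y))"
    by (intro mult_left_mono) auto
  with 1 have "t * (y \<bullet> y) \<le> 0"
    by simp
  then have "(y \<bullet> y)\<^sup>2 \<le> 0"
    using q by (simp add: t_def divide_le_0_iff power2_eq_square)
  then have "y = 0"
    by simp
  then show ?thesis
    by (simp add: y_def)
qed

text \<open>A nonzero determinant makes the kernel trivial, and the form vanishes only on the
  kernel. This recovers definiteness for matrices known only to lie in a closed set.\<close>

lemma pos_semidef_matrix_det_pos:
  fixes A :: "real^'n^'n"
  assumes A: "pos_semidef_matrix A" and "0 < det A"
  shows "pos_def_matrix A"
proof -
  obtain B where "B ** A = mat 1"
    using assms(2) invertible_det_nz[of A] unfolding invertible_def by auto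
  then have "x = 0" if "A *v x = 0" for x
    using that matrix_left_invertible_ker by blast
  then have "x \<bullet> (A *v x) \<noteq> 0" if "x \<noteq> 0" for x
    using pos_semidef_matrix_kernel[OF A] that by blast
  then show ?thesis
    using A unfolding pos_def_matrix_def pos_semidef_matrix_def by (metis less_eq_real_def)
qed

lemma pos_def_imp_pos_semidef_matrix:
  "pos_def_matrix A \<Longrightarrow> pos_semidef_matrix A"
  unfolding pos_def_matrix_def pos_semidef_matrix_def by (metis inner_zero_left less_eq_real_def)

text \<open>Evaluate the form at the sum and the difference of two basis vectors. Hence bounding the
  diagonal bounds the whole matrix.\<close>

lemma pos_semidef_matrix_entry_bound:
  fixes A :: "real^'n^'n"
  assumes A: "pos_semidef_matrix A"
  shows "2 * \<bar>A $ i $ j\<bar> \<le> A $ i $ i + A $ j $ j"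
proof -
  let ?i = "axis i 1 :: real^'n" and ?j = "axis j 1 :: real^'n"
  have "0 \<le> (?i + ?j) \<bullet> (A *v (?i + ?j))" "0 \<le> (?i - ?j) \<bullet> (A *v (?i - ?j))"
    using A unfolding pos_semidef_matrix_def by blast+
  moreover have "A $ j $ i = A $ i $ j"
    using A unfolding pos_semidef_matrix_def transpose_def by (metis vec_lambda_beta)
  ultimately show ?thesis
    by (simp add: vec.add vec.diff inner_add_left inner_add_right inner_diff_left inner_diff_right
        axis_inner_matrix)
qed

lemma continuous_on_det [continuous_intros]:
  fixes f :: "'a::topological_space \<Rightarrow> real^'n^'n"
  assumes "continuous_on X f"
  shows "continuous_on X (\<lambda>x. det (f x))"
  unfolding det_def by (intro continuous_intros assms)

text \<open>Semidefiniteness, unlike definiteness, is a closed condition; the diagonal bound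
  \<open>b\<close> also bounds the absolute value of every entry.\<close>

lemma compact_pos_semidef_matrix_set:
  fixes b c :: real
  shows "compact {A :: real^'n^'n. pos_semidef_matrix A \<and> (\<forall>i. A $ i $ i \<le> b) \<and> c \<le> det A}"
    (is "compact ?K")
proof -
  have "closed {A :: real^'n^'n. (\<forall>i j. A $ j $ i = A $ i $ j) \<and> (\<forall>x. 0 \<le> x \<bullet> (A *v x)) \<and>
      (\<forall>i. A $ i $ i \<le> b) \<and> c \<le> det A}"
    unfolding inner_vec_def matrix_vector_mult_def
    by (intro closed_Collect_conj closed_Collect_all closed_Collect_le closed_Collect_eq
        continuous_on_sum continuous_on_inner continuous_on_vec_lambda continuous_on_mult
        continuous_on_component continuous_on_det continuous_on_const continuous_on_id)
  moreover have "?K = {A. (\<forall>i j. A $ j $ i = A $ i $ j) \<and> (\<forall>x. 0 \<le> x \<bullet> (A *v x)) \<and>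
      (\<forall>i. A $ i $ i \<le> b) \<and> c \<le> det A}"
    by (auto simp: pos_semidef_matrix_def transpose_def vec_eq_iff)
  ultimately have "closed ?K"
    by simp
  moreover have "norm A \<le> norm ((\<chi> i j. b) :: real^'n^'n)" if "A \<in> ?K" for A
  proof (intro norm_le_componentwise_cart)
    fix i j
    have "2 * \<bar>A $ i $ j\<bar> \<le> A $ i $ i + A $ j $ j" "A $ i $ i \<le> b" "A $ j $ j \<le> b"
      using that pos_semidef_matrix_entry_bound by auto
    then show "norm (A $ i $ j) \<le> norm ((\<chi> i j. b) $ i $ j)"
      by simp
  qed
  then have "bounded ?K"
    unfolding bounded_iff by blast
  ultimately show ?thesis
    by (simp add: compact_eq_bounded_closed)
qed

section \<open>Lower bound for the diagonal penalty and continuity of the objective\<close>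

lemma penD_minus_ln_bounded_below:
  assumes "diag_penalty penD" and lim: "filterlim (\<lambda>x. penD x - ln x) at_top at_top"
  obtains m where "0 \<le> m" "\<And>x. 0 < x \<Longrightarrow> - m \<le> penD x - ln x"
proof -
  obtain X where X: "\<And>x. X \<le> x \<Longrightarrow> 0 \<le> penD x - ln x"
    using lim unfolding filterlim_at_top eventually_at_top_linorder by meson
  \<comment> \<open>Beyond \<open>?X\<close> the difference is nonnegative; up to \<open>?X\<close>,
    dropping the nonnegative \<open>penD x\<close> leaves at least \<open>- ln ?X\<close>. The 1
    ensures \<open>0 \<le> ln ?X\<close>.\<close>
  let ?X = "max 1 X"
  have "- ln ?X \<le> penD x - ln x" if "0 < x" for x
  proof (cases "x \<le> ?X")
    case True
    then have "ln x \<le> ln ?X" using that by simp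
    moreover have "0 \<le> penD x" using assms(1) that unfolding diag_penalty_def by blast
    ultimately show ?thesis by simp
  next
    case False
    have "0 \<le> ln ?X" by simp
    then show ?thesis using X[of x] False by linarith
  qed
  then show thesis
    using that[of "ln ?X"] by simp
qed

lemma continuous_on_l_Pen:
  fixes S :: "real^('p::{finite,linorder})^('p::{finite,linorder})"
  assumes "diag_penalty penD" "offdiag_penalty pen"
  shows "continuous_on {\<Theta>. pos_def_matrix \<Theta>} (l_Pen penD pen S)"
proof -
  let ?P = "{\<Theta> :: ((real, 'p) vec, 'p) vec. pos_def_matrix \<Theta>}"
  have nth: "continuous_on ?P (\<lambda>\<Theta>. \<Theta> $ i $ j)" for i j
    by (intro continuous_intros)
  have D: "continuous_on ?P (\<lambda>\<Theta>. penD (\<Theta> $ i $ i))" for i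
    using assms(1) nth pos_def_matrix_diag_pos unfolding diag_penalty_def
    by (intro continuous_on_compose2[of "{0<..}" penD ?P]) blast+
  have off: "continuous_on ?P (\<lambda>\<Theta>. pen (\<Theta> $ i $ j))" for i j
    using assms(2) nth unfolding offdiag_penalty_def
    by (intro continuous_on_compose2[of UNIV pen ?P]) blast+
  have det: "continuous_on ?P (\<lambda>\<Theta>. ln (det \<Theta>))"
    by (intro continuous_on_ln continuous_on_det continuous_on_id)
      (metis det_pos_def_matrix(1) less_irrefl mem_Collect_eq)
  have tr: "continuous_on ?P (\<lambda>\<Theta>. trace (S ** \<Theta>))"
    by (simp add: trace_def matrix_matrix_mult_def,
        intro continuous_on_sum continuous_on_mult continuous_on_const nth)
  show ?thesis
    unfolding l_Pen_def[abs_def] Pen_def case_prod_unfold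
    by (intro continuous_on_diff continuous_on_add continuous_on_sum det tr D off)
qed

section \<open>Existence of the maximiser by compactness\<close>

theorem proposition3:
  fixes penD pen :: "real \<Rightarrow> real"
  assumes "diag_penalty penD"
    and "offdiag_penalty pen"
    and "filterlim (\<lambda>x. penD x - ln x) at_top at_top"
  shows "\<forall>S :: real^('p::{finite,linorder})^('p::{finite,linorder}).
           pos_semidef_matrix S \<longrightarrow> penalised_estimate_exists penD pen S"
proof (intro allI impI)
  fix S :: "((real, 'p) vec, 'p) vec"
  assume S: "pos_semidef_matrix S"
  let ?l = "l_Pen penD pen S" and ?I = "mat 1 :: ((real, 'p) vec, 'p) vec"
  obtain m where m: "0 \<le> m" "\<And>x. 0 < x \<Longrightarrow> - m \<le> penD x - ln x"
    using penD_minus_ln_bounded_below[OF assms(1,3)] by blast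
  \<comment> \<open>\<open>M\<close> bounds the sum of the shifted terms
    \<open>penD (A $ i $ i) - ln (A $ i $ i) + m\<close> whenever \<open>?l ?I \<le> ?l A\<close>;
    beyond \<open>b\<close> a single term would exceed it.\<close>
  define M where "M = real CARD('p) * m - ?l ?I"
  obtain b where b: "\<And>x. b \<le> x \<Longrightarrow> M + 1 \<le> penD x - ln x"
    using assms(3) unfolding filterlim_at_top eventually_at_top_linorder by meson
  \<comment> \<open>\<open>K\<close> contains the superlevel set through \<open>?I\<close>. Its
    determinant bound comes from \<open>?l A \<le> ln (det A)\<close> and, being positive, forces
    definiteness on \<open>K\<close>.\<close>
  define K where "K = {A :: ((real, 'p) vec, 'p) vec. pos_semidef_matrix A \<and> (\<forall>i. A $ i $ i \<le> b) \<and> exp (?l ?I) \<le> det A}"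
  have I: "pos_def_matrix ?I"
    by (simp add: pos_def_matrix_def)
  have off: "0 \<le> (\<Sum>(i, j)\<in>{(i, j). i < j}. pen (A $ i $ j))" for A :: "((real, 'p) vec, 'p) vec"
    using assms(2) unfolding offdiag_penalty_def by (intro sum_nonneg) auto
  have upper: "?l A \<le> ln (det A) - (\<Sum>i\<in>UNIV. penD (A $ i $ i))" if "pos_def_matrix A" for A
    using off[of A] trace_mult_nonneg[OF S that] by (simp add: l_Pen_def Pen_def)
  have K: "A \<in> K" if A: "pos_def_matrix A" and ge: "?l ?I \<le> ?l A" for A
  proof -
    note diag = pos_def_matrix_diag_pos[OF A]
    have "0 \<le> (\<Sum>i\<in>UNIV. penD (A $ i $ i))"
      using assms(1) diag unfolding diag_penalty_def by (intro sum_nonneg) auto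
    then have "?l ?I \<le> ln (det A)"
      using upper[OF A] ge by linarith
    then have "exp (?l ?I) \<le> det A"
      using det_pos_def_matrix(1)[OF A] by (simp add: ln_ge_iff)
    moreover have "A $ i $ i \<le> b" for i
    proof (rule ccontr)
      assume "\<not> A $ i $ i \<le> b"
      then have big: "M + 1 \<le> penD (A $ i $ i) - ln (A $ i $ i)"
        using b by simp
      have "ln (det A) \<le> ln (\<Prod>i\<in>UNIV. A $ i $ i)"
        using det_pos_def_matrix(1)[OF A] hadamard_inequality[OF A] by simp
      also have "\<dots> = (\<Sum>i\<in>UNIV. ln (A $ i $ i))"
        by (intro ln_prod finite_class.finite_UNIV) (metis diag less_irrefl)
      finally have "(\<Sum>i\<in>UNIV. penD (A $ i $ i) - ln (A $ i $ i)) \<le> - ?l ?I"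
        using upper[OF A] ge by (simp add: sum_subtractf)
      then have "(\<Sum>i\<in>UNIV. penD (A $ i $ i) - ln (A $ i $ i) + m) \<le> M"
        by (simp add: sum.distrib M_def)
      \<comment> \<open>The shift by \<open>m\<close> makes every summand nonnegative, so each one
        is at most the whole sum.\<close>
      moreover have "penD (A $ i $ i) - ln (A $ i $ i) + m
          \<le> (\<Sum>i\<in>UNIV. penD (A $ i $ i) - ln (A $ i $ i) + m)"
        using m(2)[OF diag] by (intro member_le_sum) (auto simp: algebra_simps)
      ultimately show False
        using big m(1) by linarith
    qed
    ultimately show ?thesis
      using pos_def_imp_pos_semidef_matrix[OF A] by (simp add: K_def)
  qed
  have Kpos: "K \<subseteq> {A. pos_def_matrix A}"
    unfolding K_def using pos_semidef_matrix_det_pos by (auto intro: less_le_trans[OF exp_gt_zero])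
  have "compact K"
    unfolding K_def by (rule compact_pos_semidef_matrix_set)
  moreover have "K \<noteq> {}"
    using K[OF I] by auto
  ultimately obtain T where T: "T \<in> K" "\<And>A. A \<in> K \<Longrightarrow> ?l A \<le> ?l T"
    using continuous_attains_sup[OF _ _ continuous_on_subset[OF continuous_on_l_Pen[OF assms(1,2)] Kpos]]
    by metis
  \<comment> \<open>A positive definite matrix outside \<open>K\<close> has a value below
    \<open>?l ?I\<close>, and \<open>?I\<close> itself lies in \<open>K\<close>.\<close>
  have max: "?l A \<le> ?l T" if "pos_def_matrix A" for A
    using T(2)[of A] T(2)[OF K[OF I order_refl]] K[OF that] by linarith
  have "?l T = (SUP A\<in>{A. pos_def_matrix A}. ?l A)"
    using T(1) Kpos max by (intro cSup_eq_maximum[symmetric]) auto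
  then show "penalised_estimate_exists penD pen S"
    unfolding penalised_estimate_exists_def using T(1) Kpos max by (auto intro!: bdd_aboveI)
qed

end
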